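(* Let $m\ge 1$ be an integer. Put $S(m)=\{ a(mn,k) \mid n\ge 1,\ k\ge 0\}$ and $R(m)=\{ c(mn,k) \mid n\ge 1,\ k\ge 0\}$. Then $S(m)=\mathbb{Z}$ and $R(m)=\mathbb{Z}$.
   Context: For $n\ge 1$, $\Phi_n(x)=\sum_{k=0}^{\varphi(n)} a(n,k)x^k$ denotes the $n$th cyclotomic polynomial, with $a(n,k)=0$ for $k>\varphi(n)$. The integers $c(n,k)$ are defined by the Taylor expansion around $x=0$: $\frac{1}{\Phi_n(x)}=\sum_{k=0}^{\infty} c(n,k)x^k$. *)

theory Defs
  imports "HOL-Complex_Analysis.Complex_Analysis" "HOL-Number_Theory.Totient"
begin

definition cyclotomic_poly :: "nat \<Rightarrow> complex poly" where
  "cyclotomic_poly n = (\<Prod>j\<in>totatives n. [:- cis (2 * pi * real j / real n), 1:])"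

definition cyclotomic_coeff :: "nat \<Rightarrow> nat \<Rightarrow> complex" where
  "cyclotomic_coeff n k = poly.coeff (cyclotomic_poly n) k"

definition inv_cyclotomic_coeff :: "nat \<Rightarrow> nat \<Rightarrow> complex" where
  "inv_cyclotomic_coeff n k =
     fps_nth (fps_expansion (\<lambda>x. 1 / poly (cyclotomic_poly n) x) 0) k"

lemma degree_cyclotomic_poly: "degree (cyclotomic_poly n) = totient n"
  unfolding cyclotomic_poly_def by (subst degree_prod_eq_sum_degree) (auto simp: totient_def)

lemma cyclotomic_poly_0_nonzero: "poly (cyclotomic_poly n) 0 \<noteq> 0"
  unfolding cyclotomic_poly_def by (simp add: poly_prod)

lemma inv_cyclotomic_coeff_conv_inverse:
  "inv_cyclotomic_coeff n k = fps_nth (inverse (fps_of_poly (cyclotomic_poly n))) k"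
proof -
  have "poly (cyclotomic_poly n) has_fps_expansion fps_of_poly (cyclotomic_poly n)"
    by (simp add: has_fps_expansion_def)
  moreover have "fps_nth (fps_of_poly (cyclotomic_poly n)) 0 \<noteq> 0"
    using cyclotomic_poly_0_nonzero[of n] by (simp add: poly_0_coeff_0)
  ultimately have "(\<lambda>x. inverse (poly (cyclotomic_poly n) x)) has_fps_expansion
      inverse (fps_of_poly (cyclotomic_poly n))"
    by (rule has_fps_expansion_inverse)
  then show ?thesis
    unfolding inv_cyclotomic_coeff_def by (simp add: fps_expansion_eqI inverse_eq_divide)
qed

end

theory Submission
  imports Defs "HOL-Computational_Algebra.Computational_Algebra"
begin

text \<open>
  For distinct primes \<open>p\<^sub>1, \<dots>, p\<^sub>t\<close> in an interval \<open>[P, 2P)\<close> that do not divide \<open>B > 1\<close>, iterating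
  \<open>\<Phi>\<^bsub>Np\<^esub>(x) = \<Phi>\<^bsub>N\<^esub>(x\<^sup>p) / \<Phi>\<^bsub>N\<^esub>(x)\<close> shows that, modulo \<open>x\<^bsup>2P\<^esup>\<close>, the series
  \<open>(1 + a(B,1) (x\<^bsup>p\<^sub>1\<^esup> + \<dots> + x\<^bsup>p\<^sub>t\<^esup>)) / \<Phi>\<^bsub>B\<^esub>(x)\<close> is \<open>\<Phi>\<^bsub>B p\<^sub>1\<dots>p\<^sub>t\<^esub>\<close> for odd \<open>t\<close> and its inverse for
  even \<open>t\<close>. The coefficients \<open>c(B,k)\<close> have period \<open>B\<close> in \<open>k\<close>. If all \<open>p\<^sub>i\<close> lie in one residue class
  modulo \<open>B\<close>, then for \<open>k\<close> between the \<open>j\<close>-th and the next prime, the coefficient of \<open>x\<^sup>k\<close> is therefore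
  \<open>c(B,k) + a(B,1) j c(B,k-p\<^sub>1)\<close>.

  Take \<open>B = Mq\<close> with \<open>M\<close> a product of an odd number of distinct primes, among them all those dividing
  \<open>m\<close>, and \<open>q\<close> a large prime. Then \<open>a(B,1) = -1\<close> and \<open>c(B,k) = a(M, k mod q) c(M, k div q)\<close>, which
  vanishes for \<open>k mod q > \<phi>(M)\<close>. This leaves enough room to choose \<open>k\<close> with \<open>c(B,k) = 0\<close> and
  \<open>c(B,k-p\<^sub>1) = 1\<close> or \<open>-1\<close>, so every integer occurs. Finally
  \<open>\<Phi>\<^bsub>mN\<^esub>(x) = \<Phi>\<^bsub>N\<^esub>(x\<^sup>m)\<close> whenever all primes dividing \<open>m\<close> divide \<open>N\<close>.

  Dyadic intervals with many primes exist by Erdos' argument for the divergence of the sum of the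
  reciprocals of the primes; the residue class comes from the pigeonhole principle, which avoids
  Dirichlet's theorem.
\<close>

section \<open>Many primes of one residue class in a dyadic interval\<close>

text \<open>Write \<open>x = s * t ^ 2\<close> with \<open>s\<close> squarefree. Then
  \<open>s\<close> is the product of a set of primes below \<open>y\<close>, and
  \<open>t \<le> N\<close>; counting the pairs of such a set and \<open>t\<close> gives the
  bound.\<close>

lemma card_smooth_le:
  fixes N y :: nat
  shows "card {x \<in> {1..N ^ 2}. \<forall>p. prime p \<longrightarrow> p dvd x \<longrightarrow> p < y} \<le> 2 ^ y * N"
proof -
  let ?S = "{x \<in> {1..N ^ 2}. \<forall>p. prime p \<longrightarrow> p dvd x \<longrightarrow> p < y}"
  let ?f = "\<lambda>x :: nat. (prime_factors (squarefree_part x), square_part x)"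
  have "inj_on ?f ?S"
  proof (rule inj_onI)
    fix a b assume "?f a = ?f b"
    then have *: "prime_factors (squarefree_part a) = prime_factors (squarefree_part b)"
      "square_part a = square_part b" by auto
    have sq: "squarefree_part x = \<Prod>(prime_factors (squarefree_part x))" for x :: nat
    proof -
      have "squarefree_part x =
          (\<Prod>p\<in>prime_factors (squarefree_part x). p ^ multiplicity p (squarefree_part x))"
        by (intro prime_factorization_nat) (simp add: zero_less_iff_neq_zero)
      also have "\<dots> = (\<Prod>p\<in>prime_factors (squarefree_part x). p)"
        using squarefree_squarefree_part[of x]
        unfolding squarefree_factorial_semiring'[OF squarefree_part_nonzero]
        by (intro prod.cong) auto
      finally show ?thesis .
    qed
    show "a = b"
      using *(2) by (rule squarefree_decomposition_unique) (metis *(1) sq)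
  qed
  moreover have "?f ` ?S \<subseteq> Pow {..<y} \<times> {1..N}"
  proof clarify
    fix x assume x: "x \<in> {1..N ^ 2}" "\<forall>p. prime p \<longrightarrow> p dvd x \<longrightarrow> p < y"
    have "squarefree_part x dvd x"
      using dvd_triv_left[of "squarefree_part x" "square_part x ^ 2"]
      by (simp only: squarefree_decompose[symmetric])
    then have "p < y" if "p \<in> prime_factors (squarefree_part x)" for p
      using that x(2) dvd_trans by (auto simp: in_prime_factors_iff)
    moreover have "square_part x ^ 2 \<le> x"
      using x(1) by (intro dvd_imp_le square_part_square_dvd) auto
    then have "square_part x ^ 2 \<le> N ^ 2" using x(1) by (meson atLeastAtMost_iff order_trans)
    then have "square_part x \<le> N" by (simp add: power2_nat_le_eq_le)
    moreover have "1 \<le> square_part x" using x(1) by (cases "square_part x") auto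
    ultimately show "prime_factors (squarefree_part x) \<in> Pow {..<y} \<and> square_part x \<in> {1..N}"
      by auto
  qed
  ultimately have "card ?S \<le> card (Pow {..<y} \<times> {1..N})"
    by (intro card_inj_on_le) auto
  also have "\<dots> = 2 ^ y * N"
    by (simp add: card_cartesian_product card_Pow)
  finally show ?thesis .
qed

lemma card_multiples_le:
  fixes p N :: nat
  assumes "p > 0"
  shows "card {x \<in> {1..N}. p dvd x} \<le> N div p"
proof -
  have "{x \<in> {1..N}. p dvd x} \<subseteq> (\<lambda>j. p * j) ` {1..N div p}"
  proof clarify
    fix x assume x: "x \<in> {1..N}" "p dvd x"
    then obtain j where j: "x = p * j" by blast
    have "j \<le> N div p"
      using x(1) assms j by (simp add: less_eq_div_iff_mult_less_eq mult.commute)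
    with x(1) j show "x \<in> (*) p ` {1..N div p}" by (intro image_eqI[of _ _ j]) (auto intro: Suc_leI gr0I)
  qed
  then have "card {x \<in> {1..N}. p dvd x} \<le> card {1..N div p}"
    by (rule surj_card_le[rotated]) simp
  then show ?thesis by simp
qed

text \<open>
  If almost all dyadic intervals contained at most \<open>D\<close> primes, then at most half of the numbers up to
  \<open>N\<close> would have a prime factor \<open>\<ge> 2\<^sup>K\<close> once \<open>2\<^sup>K \<ge> 4D\<close>, whereas by \<open>card_smooth_le\<close> the others number
  only \<open>O(\<surd>N)\<close>.
\<close>

lemma dyadic_primes_unbounded:
  fixes D K0 :: nat
  shows "\<exists>i\<ge>K0. card {p. prime p \<and> (2 :: nat) ^ i \<le> p \<and> p < 2 ^ Suc i} > D"
proof (rule ccontr)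
  let ?Q = "\<lambda>i. {p :: nat. prime p \<and> 2 ^ i \<le> p \<and> p < 2 ^ Suc i}"
  assume "\<not> ?thesis"
  then have bd: "card (?Q i) \<le> D" if "i \<ge> K0" for i
    using that by (meson not_le)
  \<comment> \<open>Primes from \<open>2 ^ K\<close> on have at most
    \<open>D * N * (2 / 2 ^ K)\<close> multiples up to \<open>N\<close>; the bound
    \<open>4 * D \<le> 2 ^ K\<close> turns this into \<open>N / 2\<close>.\<close>
  define K where "K = K0 + 2 * D + 2"
  have K: "4 * D \<le> 2 ^ K" "K \<ge> K0"
  proof -
    have "4 * D \<le> 2 * 2 ^ (2 * D)" using less_exp[of "2 * D"] by linarith
    also have "\<dots> \<le> 2 ^ K" unfolding power_Suc[symmetric] by (intro power_increasing) (auto simp: K_def)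
    finally show "4 * D \<le> 2 ^ K" .
  qed (simp add: K_def)
  define y :: nat where "y = 2 ^ K"
  \<comment> \<open>\<open>N\<close> is a square to suit \<open>card_smooth_le\<close>, and
    \<open>e > y + 1\<close> makes twice the smooth count, \<open>2 ^ (y + e + 1)\<close>, smaller
    than \<open>N = 2 ^ (e * 2)\<close>.\<close>
  define e where "e = y + 2"
  define N :: nat where "N = (2 ^ e) ^ 2"
  let ?S = "{x \<in> {1..N}. \<forall>p. prime p \<longrightarrow> p dvd x \<longrightarrow> p < y}"
  have finQ: "finite (?Q i)" for i
    by (rule finite_subset[of _ "{..<2 ^ Suc i}"]) auto
  \<comment> \<open>The range \<open>i < N\<close> is crude: it comes from
    \<open>2 ^ i \<le> p \<le> N\<close> and keeps the union finite.\<close>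
  have cover: "{1..N} \<subseteq> ?S \<union> (\<Union>i\<in>{K..<N}. \<Union>p\<in>?Q i. {x \<in> {1..N}. p dvd x})"
  proof
    fix x assume x: "x \<in> {1..N}"
    show "x \<in> ?S \<union> (\<Union>i\<in>{K..<N}. \<Union>p\<in>?Q i. {x \<in> {1..N}. p dvd x})"
    proof (cases "x \<in> ?S")
      case False
      then obtain p where p: "prime p" "p dvd x" "y \<le> p" using x by (auto simp: not_less)
      obtain i where i: "2 ^ i \<le> p" "p < 2 ^ Suc i"
        using ex_power_ivl1[of 2 p] p(1) prime_gt_0_nat[of p] by auto
      have "2 ^ K < (2 :: nat) ^ Suc i" using p(3) i(2) unfolding y_def by linarith
      then have "K \<le> i"
        by (metis less_Suc_eq_le one_less_numeral_iff power_strict_increasing_iff semiring_norm(76))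
      have "p \<le> N" using p(2) x dvd_imp_le[of p x] by auto
      then have "i < N" using i(1) less_exp[of i] by linarith
      with \<open>K \<le> i\<close> i p x show ?thesis
        by (intro UnI2 UN_I[of i] UN_I[of p]) auto
    qed blast
  qed
  have "real (card (\<Union>i\<in>{K..<N}. \<Union>p\<in>?Q i. {x \<in> {1..N}. p dvd x})) \<le>
      real (\<Sum>i\<in>{K..<N}. \<Sum>p\<in>?Q i. card {x \<in> {1..N}. p dvd x})"
    unfolding of_nat_le_iff
    by (intro order_trans[OF card_UN_le] sum_mono card_UN_le finQ) auto
  also have "\<dots> \<le> (\<Sum>i\<in>{K..<N}. real D * (real N / 2 ^ i))"
    unfolding of_nat_sum
  proof (rule sum_mono)
    fix i assume i: "i \<in> {K..<N}"
    have "(\<Sum>p\<in>?Q i. real (card {x \<in> {1..N}. p dvd x})) \<le> (\<Sum>p\<in>?Q i. real N / 2 ^ i)"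
    proof (rule sum_mono)
      fix p assume p: "p \<in> ?Q i"
      have "real (card {x \<in> {1..N}. p dvd x}) \<le> real (N div p)"
        using p by (intro of_nat_mono card_multiples_le) (auto simp: prime_gt_0_nat)
      also have "\<dots> \<le> real N / real p" by (rule of_nat_div_le_of_nat)
      also have "\<dots> \<le> real N / 2 ^ i"
      proof (intro divide_left_mono)
        show "2 ^ i \<le> real p"
          using p by (metis (mono_tags, lifting) mem_Collect_eq numeral_power_le_of_nat_cancel_iff)
        show "0 < real p * 2 ^ i" using p by (auto simp: prime_gt_0_nat)
      qed simp
      finally show "real (card {x \<in> {1..N}. p dvd x}) \<le> real N / 2 ^ i" .
    qed
    also have "\<dots> \<le> real D * (real N / 2 ^ i)"
      using bd[of i] i K by (auto intro!: mult_right_mono divide_right_mono)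
    finally show "(\<Sum>p\<in>?Q i. real (card {x \<in> {1..N}. p dvd x})) \<le> real D * (real N / 2 ^ i)" .
  qed
  also have "\<dots> = real D * real N * (\<Sum>i\<in>{K..<N}. (1 / 2) ^ i)"
    by (simp add: sum_distrib_left power_one_over field_simps)
  also have "(\<Sum>i\<in>{K..<N}. (1 / 2 :: real) ^ i) \<le> 2 * (1 / 2) ^ K"
  proof (cases "K \<le> N")
    case True
    then have "(\<Sum>i\<in>{K..<N}. (1 / 2 :: real) ^ i) = 2 * (1 / 2) ^ K - 2 * (1 / 2) ^ N"
      by (induction N rule: dec_induct) auto
    then show ?thesis by simp
  qed auto
  then have "real D * real N * (\<Sum>i\<in>{K..<N}. (1 / 2) ^ i) \<le> real D * real N * (2 * (1 / 2) ^ K)"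
    by (intro mult_left_mono) auto
  also have "\<dots> \<le> real N / 2"
  proof -
    have "real (4 * D) \<le> real (2 ^ K)" using K(1) by (rule of_nat_mono)
    then have "4 * real D * real N \<le> 2 ^ K * real N" by (intro mult_right_mono) auto
    then show ?thesis by (simp add: field_simps power_one_over)
  qed
  finally have big: "2 * card (\<Union>i\<in>{K..<N}. \<Union>p\<in>?Q i. {x \<in> {1..N}. p dvd x}) \<le> N"
    by linarith
  have "N = card {1..N}" by simp
  also have "\<dots> \<le> card (?S \<union> (\<Union>i\<in>{K..<N}. \<Union>p\<in>?Q i. {x \<in> {1..N}. p dvd x}))"
    by (rule card_mono[OF _ cover]) (auto intro: finQ)
  also have "\<dots> \<le> card ?S + card (\<Union>i\<in>{K..<N}. \<Union>p\<in>?Q i. {x \<in> {1..N}. p dvd x})"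
    by (rule card_Un_le)
  finally have "N \<le> 2 * card ?S" using big by linarith
  also have "card ?S \<le> 2 ^ y * 2 ^ e"
    unfolding N_def by (rule card_smooth_le)
  finally have "N \<le> 2 * (2 ^ y * 2 ^ e)" by simp
  also have "\<dots> = 2 ^ (y + e + 1)" by (simp add: power_add)
  also have "\<dots> < 2 ^ (e * 2)" by (intro power_strict_increasing) (auto simp: e_def)
  also have "\<dots> = N" by (simp add: N_def power_mult)
  finally show False by simp
qed

text \<open>Pigeonhole over \<open>B\<close> classes, for an interval with more than
  \<open>B * t\<close> primes. Which class \<open>r\<close> arises is left open; it will suffice
  that the primes differ by multiples of \<open>B\<close>.\<close>

lemma primes_in_residue_class_unbounded:
  fixes B t L :: nat
  assumes "B > 0"
  obtains P r where "P \<ge> L" "t \<le> card {p. prime p \<and> P \<le> p \<and> p < 2 * P \<and> p mod B = r}"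
proof -
  obtain i where i: "i \<ge> L" "card {p :: nat. prime p \<and> 2 ^ i \<le> p \<and> p < 2 ^ Suc i} > B * t"
    using dyadic_primes_unbounded by blast
  let ?Q = "{p :: nat. prime p \<and> 2 ^ i \<le> p \<and> p < 2 ^ Suc i}"
  let ?R = "\<lambda>r. {p :: nat. prime p \<and> 2 ^ i \<le> p \<and> p < 2 * 2 ^ i \<and> p mod B = r}"
  have "\<exists>r. t \<le> card (?R r)"
  proof (rule ccontr)
    assume "\<not> (\<exists>r. t \<le> card (?R r))"
    then have le: "card (?R r) \<le> t" for r by (meson nle_le)
    have "?Q = (\<Union>r\<in>{..<B}. ?R r)" using assms by auto
    then have "card ?Q \<le> (\<Sum>r<B. card (?R r))" using card_UN_le[of "{..<B}" ?R] by simp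
    also have "\<dots> \<le> (\<Sum>r<B. t)" by (intro sum_mono le)
    finally show False using i(2) by simp
  qed
  moreover have "L \<le> 2 ^ i" using i(1) less_exp[of i] by linarith
  ultimately show ?thesis using that by blast
qed

section \<open>Identities between cyclotomic polynomials\<close>

text \<open>Both sides are monic of degree \<open>L\<close> and vanish at the same \<open>L\<close>
  points, which are distinct because \<open>w \<noteq> 0\<close>.\<close>

lemma prod_root_of_unity_translates:
  fixes w :: complex
  assumes "L > 0" "w \<noteq> 0"
  shows "(\<Prod>i<L. [:- (w * cis (2 * pi * real i / real L)), 1:]) = monom 1 L - [:w ^ L:]"
proof -
  define f where "f = (\<lambda>i. w * cis (2 * pi * real i / real L))"
  have bij: "bij_betw (\<lambda>k. cis (2 * pi * real k / real L)) {..<L} {z. z ^ L = 1}"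
    using assms(1) by (rule Complex.bij_betw_roots_unity)
  have inj: "inj_on f {..<L}"
    using bij assms(2) by (auto simp: f_def bij_betw_def inj_on_def)
  have pw: "f i ^ L = w ^ L" if "i < L" for i
    using bij that by (auto simp: f_def bij_betw_def power_mult_distrib)
  have deg: "degree (\<Prod>i<L. [:- f i, 1:]) = L"
    by (subst degree_prod_eq_sum_degree) auto
  have deg': "degree (monom 1 L - [:w ^ L:]) = L"
    using assms(1) by (subst diff_conv_add_uminus, subst degree_add_eq_left) (auto simp: degree_monom_eq)
  have "(\<Prod>i<L. [:- f i, 1:]) = monom 1 L - [:w ^ L:]"
  proof (rule poly_eqI_degree_lead_coeff[where n = L and A = "f ` {..<L}"])
    have "lead_coeff (\<Prod>i<L. [:- f i, 1:]) = 1"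
      by (simp add: lead_coeff_prod)
    then show "coeff (\<Prod>i<L. [:- f i, 1:]) L = coeff (monom 1 L - [:w ^ L:]) L"
      using deg assms(1) by (auto simp: coeff_pCons split: nat.splits)
  qed (use deg deg' inj pw in \<open>auto simp: card_image poly_prod poly_monom\<close>)
  then show ?thesis
    by (simp add: f_def)
qed

lemma coprime_add_mult_right_nat:
  "coprime (j + i * N) N \<longleftrightarrow> coprime j (N :: nat)"
  by (metis coprime_mod_left_iff coprime_0_left_iff coprime_0_right_iff add_0_right mult_0_right mod_mult_self1)

text \<open>The \<open>L\<close>-th roots of \<open>cis (2 * pi * j / N)\<close> are
  \<open>cis (2 * pi * (j + i * N) / (N * L))\<close> for \<open>i < L\<close>, and
  \<open>j + i * N\<close> meets each \<open>l\<close> coprime to \<open>N\<close> once. The next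
  two identities compare this index set with the totatives of \<open>N * L\<close>.\<close>

lemma cyclotomic_poly_pcompose_monom:
  assumes "N > 0" "L > 0"
  shows "pcompose (cyclotomic_poly N) (monom 1 L) =
    (\<Prod>l | 0 < l \<and> l \<le> N * L \<and> coprime l N. [:- cis (2 * pi * real l / real (N * L)), 1:])"
proof -
  let ?S = "{l. 0 < l \<and> l \<le> N * L \<and> coprime l N}"
  \<comment> \<open>Totatives lie in \<open>1..N\<close>, so the inverse map divides
    \<open>l - 1\<close>, not \<open>l\<close>, with remainder.\<close>
  have bij: "bij_betw (\<lambda>(j, i). j + i * N) (totatives N \<times> {..<L}) ?S"
  proof (rule bij_betwI[where g = "\<lambda>l. ((l - 1) mod N + 1, (l - 1) div N)"])
    show "(\<lambda>(j, i). j + i * N) \<in> totatives N \<times> {..<L} \<rightarrow> ?S"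
    proof (clarsimp simp: totatives_def, intro conjI)
      fix j i assume *: "j \<le> N" "coprime j N" "i < L"
      have "j + i * N \<le> Suc i * N" using * by simp
      also have "\<dots> \<le> L * N" using * by (intro mult_le_mono) auto
      finally show "j + i * N \<le> N * L" by (simp add: mult.commute)
      show "coprime (j + i * N) N"
        using *(2) by (simp add: coprime_add_mult_right_nat)
    qed
    show "(\<lambda>l. ((l - 1) mod N + 1, (l - 1) div N)) \<in> ?S \<rightarrow> totatives N \<times> {..<L}"
    proof (clarsimp simp: totatives_def, intro conjI)
      fix l assume *: "0 < l" "l \<le> N * L" "coprime l N"
      show "Suc ((l - Suc 0) mod N) \<le> N"
        using assms(1) by (simp add: Suc_leI)
      have "l = Suc ((l - 1) mod N) + (l - 1) div N * N"
        using *(1) by simp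
      then have "coprime (Suc ((l - 1) mod N) + (l - 1) div N * N) N"
        using *(3) by metis
      then show "coprime (Suc ((l - Suc 0) mod N)) N"
        by (simp only: coprime_add_mult_right_nat One_nat_def)
      have "l - 1 < L * N" using * by (simp add: mult.commute) 
      then show "(l - Suc 0) div N < L"
        by (simp add: less_mult_imp_div_less)
    qed
    show "(\<lambda>l. ((l - 1) mod N + 1, (l - 1) div N)) ((\<lambda>(j, i). j + i * N) x) = x"
      if x: "x \<in> totatives N \<times> {..<L}" for x
    proof -
      obtain j i where "x = (j, i)" "0 < j" "j \<le> N"
        using x by (auto simp: totatives_def)
      then show ?thesis by (cases j) simp_all
    qed
    show "(\<lambda>(j, i). j + i * N) ((l - 1) mod N + 1, (l - 1) div N) = l" if "l \<in> ?S" for l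
      using that by (simp add: mod_div_mult_eq)
  qed
  have "(\<Prod>l\<in>?S. [:- cis (2 * pi * real l / real (N * L)), 1:]) =
      (\<Prod>(j, i)\<in>totatives N \<times> {..<L}. [:- cis (2 * pi * real (j + i * N) / real (N * L)), 1:])"
    by (subst prod.reindex_bij_betw[OF bij, symmetric]) (simp add: case_prod_unfold)
  also have "\<dots> = (\<Prod>j\<in>totatives N. \<Prod>i<L.
      [:- (cis (2 * pi * real j / real (N * L)) * cis (2 * pi * real i / real L)), 1:])"
    unfolding prod.cartesian_product
    using assms by (intro prod.cong) (auto simp: cis_mult field_simps)
  also have "\<dots> = (\<Prod>j\<in>totatives N. monom 1 L - [:cis (2 * pi * real j / real (N * L)) ^ L:])"
    using assms(2) by (intro prod.cong refl prod_root_of_unity_translates) auto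
  also have "\<dots> = (\<Prod>j\<in>totatives N. monom 1 L - [:cis (2 * pi * real j / real N):])"
    unfolding Complex.DeMoivre using assms by (intro prod.cong) auto
  also have "\<dots> = pcompose (cyclotomic_poly N) (monom 1 L)"
    by (simp add: cyclotomic_poly_def pcompose_prod pcompose_pCons
        diff_conv_add_uminus add.commute del: add_uminus_conv_diff)
  finally show ?thesis ..
qed

text \<open>Here coprime to \<open>N\<close> already means coprime to \<open>N * L\<close>, so the
  index set is \<open>totatives (N * L)\<close>.\<close>

lemma cyclotomic_poly_mult_absorb:
  assumes "N > 0" "L > 0" "\<And>p. prime p \<Longrightarrow> p dvd L \<Longrightarrow> p dvd N"
  shows "cyclotomic_poly (N * L) = pcompose (cyclotomic_poly N) (monom 1 L)"
proof -
  have "coprime l L" if "coprime l N" for l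
    
  proof (rule ccontr)
    assume "\<not> coprime l L"
    then obtain p where "prime p" "p dvd l" "p dvd L"
      by (metis coprime_iff_gcd_eq_1 gcd_nat.bounded_iff prime_factor_nat dvd_refl)
    with assms(3) that show False
      by (metis coprime_common_divisor not_prime_unit)
  qed
  then have "totatives (N * L) = {l. 0 < l \<and> l \<le> N * L \<and> coprime l N}"
    by (auto simp: totatives_def)
  then show ?thesis
    using assms(1,2) by (simp only: cyclotomic_poly_pcompose_monom) (simp add: cyclotomic_poly_def)
qed

text \<open>Among the indices coprime to \<open>N\<close>, those prime to \<open>p\<close> give
  \<open>cyclotomic_poly (N * p)\<close>, and the multiples \<open>p * j\<close> give back the roots
  of \<open>cyclotomic_poly N\<close>.\<close>

lemma cyclotomic_poly_mult_prime:
  assumes "N > 0" "prime p" "\<not> p dvd N"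
  shows "cyclotomic_poly (N * p) * cyclotomic_poly N = pcompose (cyclotomic_poly N) (monom 1 p)"
proof -
  let ?S = "{l. 0 < l \<and> l \<le> N * p \<and> coprime l N}"
  let ?f = "\<lambda>l. [:- cis (2 * pi * real l / real (N * p)), 1:]"
  have p: "p > 0" using assms(2) by (simp add: prime_gt_0_nat)
  have cop: "coprime p N" using assms(2,3) by (simp add: prime_imp_coprime)
  have "?S = totatives (N * p) \<union> (\<lambda>j. p * j) ` totatives N"
  proof (intro set_eqI iffI)
    fix l assume l: "l \<in> ?S"
    show "l \<in> totatives (N * p) \<union> (\<lambda>j. p * j) ` totatives N"
    proof (cases "p dvd l")
      case True
      then obtain j where "l = p * j" by blast
      with l p show ?thesis by (auto simp: totatives_def mult.commute)
    next
      case False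
      then have "coprime l p" using assms(2) by (metis coprime_commute prime_imp_coprime)
      with l show ?thesis by (auto simp: totatives_def)
    qed
  next
    fix l assume "l \<in> totatives (N * p) \<union> (\<lambda>j. p * j) ` totatives N"
    then show "l \<in> ?S" using p cop by (auto simp: totatives_def mult.commute)
  qed
  moreover have "totatives (N * p) \<inter> (\<lambda>j. p * j) ` totatives N = {}"
    using assms(2) by (auto simp: totatives_def)
  ultimately have "prod ?f ?S = prod ?f (totatives (N * p)) * prod ?f ((\<lambda>j. p * j) ` totatives N)"
    by (simp add: prod.union_disjoint)
  also have "prod ?f ((\<lambda>j. p * j) ` totatives N) = cyclotomic_poly N"
    using p by (subst prod.reindex) (auto simp: inj_on_def cyclotomic_poly_def field_simps intro!: prod.cong)
  finally show ?thesis
    unfolding cyclotomic_poly_pcompose_monom[OF assms(1) p]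
    by (simp add: cyclotomic_poly_def)
qed

lemma cyclotomic_poly_1: "cyclotomic_poly 1 = [:-1, 1:]"
  by (simp add: cyclotomic_poly_def)

text \<open>The cofactor collects the \<open>m\<close>-th roots of unity that are not primitive. Its
  degree is below \<open>m\<close> since \<open>1\<close> is a totative; periodicity of the inverse
  coefficients rests on this.\<close>

lemma cyclotomic_poly_dvd:
  assumes "m > 0"
  obtains G where "monom 1 m - 1 = cyclotomic_poly m * G" "degree G < m"
proof -
  let ?f = "\<lambda>l. [:- cis (2 * pi * real l / real m), 1:]"
  let ?R = "{0<..m} - totatives m"
  have "monom 1 m - 1 = pcompose (cyclotomic_poly 1) (monom 1 m)"
    by (simp only: cyclotomic_poly_1) (simp add: pcompose_pCons one_pCons)
  also have "\<dots> = (\<Prod>l\<in>{0<..m}. ?f l)"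
    using assms by (subst cyclotomic_poly_pcompose_monom) (auto intro!: prod.cong)
  also have "\<dots> = (\<Prod>l\<in>totatives m. ?f l) * (\<Prod>l\<in>?R. ?f l)"
    by (subst prod.subset_diff[of "totatives m"]) (auto simp: totatives_def mult.commute)
  finally have "monom 1 m - 1 = cyclotomic_poly m * (\<Prod>l\<in>?R. ?f l)"
    by (simp add: cyclotomic_poly_def)
  moreover have "degree (\<Prod>l\<in>?R. ?f l) = card ?R"
    by (subst degree_prod_eq_sum_degree) auto
  moreover have "card ?R < card {0<..m}"
  proof (rule psubset_card_mono)
    have "1 \<in> totatives m" "1 \<in> {0<..m}" using assms by (auto simp: totatives_def)
    then show "?R \<subset> {0<..m}" by blast
  qed auto
  ultimately show ?thesis
    by (intro that[of "\<Prod>l\<in>?R. ?f l"]) simp_all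
qed

section \<open>Cyclotomic polynomials as invertible power series; periodicity of the inverse
  coefficients\<close>

definition cyclotomic_fps :: "nat \<Rightarrow> complex fps" where
  "cyclotomic_fps n = fps_of_poly (cyclotomic_poly n)"

lemma cyclotomic_fps_nth: "fps_nth (cyclotomic_fps n) k = cyclotomic_coeff n k"
  by (simp add: cyclotomic_fps_def cyclotomic_coeff_def)

lemma inverse_cyclotomic_fps_nth:
  "fps_nth (inverse (cyclotomic_fps n)) k = inv_cyclotomic_coeff n k"
  by (simp add: cyclotomic_fps_def inv_cyclotomic_coeff_conv_inverse)

lemma cyclotomic_fps_nth_0_nonzero: "fps_nth (cyclotomic_fps n) 0 \<noteq> 0"
  using cyclotomic_poly_0_nonzero[of n] by (simp add: cyclotomic_fps_def poly_0_coeff_0)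

lemma cyclotomic_fps_nth_eq_0: "k > totient n \<Longrightarrow> fps_nth (cyclotomic_fps n) k = 0"
  by (simp add: cyclotomic_fps_def coeff_eq_0 degree_cyclotomic_poly)

lemma cyclotomic_fps_nth_totient: "fps_nth (cyclotomic_fps n) (totient n) = 1"
proof -
  have "lead_coeff (cyclotomic_poly n) = 1"
    by (simp add: cyclotomic_poly_def lead_coeff_prod)
  then show ?thesis
    by (simp add: cyclotomic_fps_def degree_cyclotomic_poly)
qed

lemma fps_of_poly_pcompose_monom:
  fixes p :: "complex poly"
  assumes "L > 0"
  shows "fps_of_poly (pcompose p (monom 1 L)) = fps_of_poly p oo fps_X ^ L"
  using assms by (subst fps_of_poly_pcompose) (auto simp: fps_of_poly_monom')

lemma cyclotomic_fps_mult_absorb: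
  assumes "N > 0" "L > 0" "\<And>p. prime p \<Longrightarrow> p dvd L \<Longrightarrow> p dvd N"
  shows "cyclotomic_fps (N * L) = cyclotomic_fps N oo fps_X ^ L"
  unfolding cyclotomic_fps_def
  using assms by (simp add: cyclotomic_poly_mult_absorb fps_of_poly_pcompose_monom)

lemma cyclotomic_fps_mult_prime:
  assumes "N > 0" "prime p" "\<not> p dvd N"
  shows "cyclotomic_fps (N * p) = (cyclotomic_fps N oo fps_X ^ p) * inverse (cyclotomic_fps N)"
proof -
  have "cyclotomic_fps (N * p) * cyclotomic_fps N = cyclotomic_fps N oo fps_X ^ p"
    using cyclotomic_poly_mult_prime[OF assms] prime_gt_0_nat[OF assms(2)]
    unfolding cyclotomic_fps_def fps_of_poly_mult[symmetric]
    by (simp add: fps_of_poly_pcompose_monom)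
  then have "(cyclotomic_fps N oo fps_X ^ p) * inverse (cyclotomic_fps N) =
      cyclotomic_fps (N * p) * (cyclotomic_fps N * inverse (cyclotomic_fps N))"
    by (simp add: mult.assoc)
  also have "cyclotomic_fps N * inverse (cyclotomic_fps N) = 1"
    using cyclotomic_fps_nth_0_nonzero inverse_mult_eq_1' by blast
  finally show ?thesis by simp
qed

lemma inverse_cyclotomic_fps_mult_prime:
  assumes "N > 0" "prime p" "\<not> p dvd N"
  shows "inverse (cyclotomic_fps (N * p)) =
    (inverse (cyclotomic_fps N) oo fps_X ^ p) * cyclotomic_fps N"
  using prime_gt_0_nat[OF assms(2)]
  by (simp add: cyclotomic_fps_mult_prime[OF assms] fps_inverse_mult fps_inverse_compose
      cyclotomic_fps_nth_0_nonzero)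

text \<open>The quotient of \<open>x^m - 1\<close> by the cyclotomic polynomial is a polynomial of
  degree below \<open>m\<close>, so its coefficient at \<open>k + m\<close>, which is
  \<open>c(m,k) - c(m,k+m)\<close>, vanishes.\<close>

lemma inv_cyclotomic_coeff_periodic:
  assumes "m > 0"
  shows "inv_cyclotomic_coeff m (k + m) = inv_cyclotomic_coeff m k"
proof -
  obtain G where G: "monom 1 m - 1 = cyclotomic_poly m * G" "degree G < m"
    using cyclotomic_poly_dvd[OF assms] .
  let ?C = "inverse (cyclotomic_fps m)"
  have "fps_X ^ m - 1 = cyclotomic_fps m * fps_of_poly G"
    using arg_cong[OF G(1), of fps_of_poly]
    by (simp add: cyclotomic_fps_def fps_of_poly_mult fps_of_poly_diff fps_of_poly_monom')
  then have "?C * (fps_X ^ m - 1) = (?C * cyclotomic_fps m) * fps_of_poly G"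
    by (simp add: mult.assoc)
  also have "?C * cyclotomic_fps m = 1"
    using cyclotomic_fps_nth_0_nonzero inverse_mult_eq_1 by blast
  finally have "?C * fps_X ^ m - ?C = fps_of_poly G"
    by (simp add: algebra_simps)
  then have "fps_nth (?C * fps_X ^ m - ?C) (k + m) = coeff G (k + m)"
    by simp
  also have "\<dots> = 0"
    using G(2) by (intro coeff_eq_0) simp
  finally show ?thesis
    by (simp add: fps_X_power_mult_right_nth inverse_cyclotomic_fps_nth)
qed

lemma inv_cyclotomic_coeff_add_multiple:
  assumes "m > 0"
  shows "inv_cyclotomic_coeff m (k + l * m) = inv_cyclotomic_coeff m k"
  by (induction l) (use inv_cyclotomic_coeff_periodic[OF assms, of "k + _ * m"] in
    \<open>auto simp: algebra_simps\<close>)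

section \<open>Integrality\<close>

lemma fps_inverse_nth_Ints:
  fixes f :: "'a :: field fps"
  assumes f: "\<And>k. fps_nth f k \<in> \<int>" and f0: "inverse (fps_nth f 0) \<in> \<int>"
  shows "fps_nth (inverse f) k \<in> \<int>"
proof (induction k rule: less_induct)
  case (less k)
  show ?case
  proof (cases k)
    case 0
    then show ?thesis using f0 by simp
  next
    case (Suc n)
    have "fps_nth (inverse f) k =
        - (inverse (fps_nth f 0) * (\<Sum>i = 1..k. fps_nth f i * fps_nth (inverse f) (k - i)))"
      using Suc by (simp add: fps_inverse_def)
    also have "\<dots> \<in> \<int>"
      using f f0 less by (intro Ints_minus Ints_mult Ints_sum) auto
    finally show ?thesis .
  qed
qed

lemma fps_mult_nth_Ints:
  fixes f g :: "'a :: ring_1 fps"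
  assumes "\<And>k. fps_nth f k \<in> \<int>" "\<And>k. fps_nth g k \<in> \<int>"
  shows "fps_nth (f * g) k \<in> \<int>"
  unfolding fps_mult_nth using assms by (intro Ints_sum Ints_mult)

lemma cyclotomic_fps_1: "cyclotomic_fps 1 = fps_X - 1"
  unfolding cyclotomic_fps_def cyclotomic_poly_1 by (simp add: fps_of_poly_pCons algebra_simps)

text \<open>Induction by splitting off one prime \<open>p\<close> from \<open>n = N * p\<close>. The
  claim on the constant term is carried along because the case \<open>\<not> p dvd N\<close> divides
  by \<open>cyclotomic_fps N\<close>.\<close>

lemma cyclotomic_fps_Ints:
  assumes "n > 0"
  shows "(\<forall>k. fps_nth (cyclotomic_fps n) k \<in> \<int>) \<and> inverse (fps_nth (cyclotomic_fps n) 0) \<in> \<int>"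
  using assms
proof (induction n rule: less_induct)
  case (less n)
  show ?case
  proof (cases "n = 1")
    case True
    then show ?thesis
      using cyclotomic_fps_1 by (auto simp: fps_X_def)
  next
    case False
    then obtain p where p: "prime p" "p dvd n" using prime_factor_nat by blast
    then obtain N where N: "n = N * p" by (metis dvdE mult.commute)
    have "N > 0" "N < n" using less.prems N prime_gt_1_nat[OF p(1)] by auto
    with less.IH[of N] have IH: "\<And>k. fps_nth (cyclotomic_fps N) k \<in> \<int>"
      "inverse (fps_nth (cyclotomic_fps N) 0) \<in> \<int>" by auto
    show ?thesis
    proof (cases "p dvd N")
      case True
      then have "cyclotomic_fps n = cyclotomic_fps N oo fps_X ^ p"
        unfolding N using \<open>N > 0\<close> p(1) by (intro cyclotomic_fps_mult_absorb)
          (auto simp: prime_gt_0_nat primes_dvd_imp_eq)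
      then show ?thesis
        using IH by (simp add: fps_nth_compose_X_power)
    next
      case False
      then have eq: "cyclotomic_fps n = (cyclotomic_fps N oo fps_X ^ p) * inverse (cyclotomic_fps N)"
        unfolding N using \<open>N > 0\<close> p(1) by (intro cyclotomic_fps_mult_prime)
      have "\<forall>k. fps_nth (cyclotomic_fps n) k \<in> \<int>"
        unfolding eq using IH
        by (intro allI fps_mult_nth_Ints fps_inverse_nth_Ints) (auto simp: fps_nth_compose_X_power)
      moreover have "fps_nth (cyclotomic_fps n) 0 = 1"
        unfolding eq using cyclotomic_fps_nth_0_nonzero[of N]
        by (simp add: fps_nth_compose_X_power)
      ultimately show ?thesis by simp
    qed
  qed
qed

lemma cyclotomic_coeff_Ints:
  assumes "n > 0" shows "cyclotomic_coeff n k \<in> \<int>"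
  using cyclotomic_fps_Ints[OF assms] by (simp add: cyclotomic_fps_nth)

lemma inv_cyclotomic_coeff_Ints:
  assumes "n > 0" shows "inv_cyclotomic_coeff n k \<in> \<int>"
  using cyclotomic_fps_Ints[OF assms] fps_inverse_nth_Ints[of "cyclotomic_fps n"]
  by (simp add: inverse_cyclotomic_fps_nth)

section \<open>Low-order and inverse coefficients\<close>

text \<open>Modulo \<open>x^2\<close> the series \<open>Phi_N(x^p)\<close> is its constant term, so
  adjoining \<open>p\<close> sends the linear coefficient \<open>a1\<close> to
  \<open>- a1 / a0\<close>. As \<open>a0 = -1\<close> only for the empty product, the sign
  alternates from the first prime on.\<close>

lemma cyclotomic_fps_prod_primes:
  assumes "finite A" "\<And>p. p \<in> A \<Longrightarrow> prime p"
  shows "fps_nth (cyclotomic_fps (\<Prod>A)) 0 = (if A = {} then -1 else 1) \<and>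
    fps_nth (cyclotomic_fps (\<Prod>A)) 1 = (if A = {} then 1 else (-1) ^ (card A + 1))"
  using assms
proof (induction A rule: finite_induct)
  case empty
  then show ?case using cyclotomic_fps_1 by simp
next
  case (insert p A)
  let ?N = "\<Prod>A"
  have p: "prime p" "p > 1" using insert.prems prime_gt_1_nat by auto
  have "\<not> p dvd ?N"
    using insert.hyps insert.prems p
    by (metis insertCI prime_dvd_prod_iff primes_dvd_imp_eq)
  moreover have "?N > 0"
    using insert.prems by (intro prod_pos) (auto simp: prime_gt_0_nat)
  ultimately have eq: "cyclotomic_fps (?N * p) = (cyclotomic_fps ?N oo fps_X ^ p) * inverse (cyclotomic_fps ?N)"
    using p by (intro cyclotomic_fps_mult_prime)
  have "fps_nth (inverse (cyclotomic_fps ?N)) 1 =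
      - fps_nth (cyclotomic_fps ?N) 1 / fps_nth (cyclotomic_fps ?N) 0 ^ 2"
    by (simp add: fps_inverse_def field_simps power2_eq_square)
  with eq show ?case
    using insert p by (auto simp: mult.commute[of p] fps_mult_nth_1 fps_nth_compose_X_power)
qed

text \<open>In \<open>1 / Phi_{Nq}(x) = Phi_N(x) / Phi_N(x^q)\<close> the denominator contributes
  only multiples of \<open>q\<close> and the numerator has degree below \<open>q\<close>. Division
  with remainder thus leaves one term in the Cauchy product.\<close>

lemma inv_cyclotomic_coeff_mult_prime:
  assumes "N > 0" "prime q" "\<not> q dvd N" "totient N < q"
  shows "inv_cyclotomic_coeff (N * q) k =
    cyclotomic_coeff N (k mod q) * inv_cyclotomic_coeff N (k div q)"
proof -
  let ?f = "cyclotomic_fps N"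
  let ?h = "inverse ?f oo fps_X ^ q"
  have q: "q > 0" using assms(2) by (simp add: prime_gt_0_nat)
  have "inv_cyclotomic_coeff (N * q) k = fps_nth (?f * ?h) k"
    by (simp add: inverse_cyclotomic_fps_nth[symmetric] inverse_cyclotomic_fps_mult_prime assms(1-3)
        mult.commute)
  also have "\<dots> = (\<Sum>i=0..k. fps_nth ?f i * fps_nth ?h (k - i))"
    by (simp add: fps_mult_nth)
  also have "\<dots> = (\<Sum>i\<in>{k mod q}. fps_nth ?f i * fps_nth ?h (k - i))"
  proof (rule sum.mono_neutral_right)
    show "\<forall>i\<in>{0..k} - {k mod q}. fps_nth ?f i * fps_nth ?h (k - i) = 0"
    proof
      fix i assume i: "i \<in> {0..k} - {k mod q}"
      show "fps_nth ?f i * fps_nth ?h (k - i) = 0"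
      proof (cases "totient N < i")
        case True
        then show ?thesis by (simp add: cyclotomic_fps_nth_eq_0)
      next
        case False
        then have "i < q" using assms(4) by simp
        then have "\<not> q dvd k - i"
          using i by (metis DiffD1 DiffD2 atLeastAtMost_iff mod_eq_dvd_iff_nat mod_less singletonI)
        then show ?thesis by (simp add: fps_nth_compose_X_power)
      qed
    qed
  qed auto
  also have "\<dots> = cyclotomic_coeff N (k mod q) * inv_cyclotomic_coeff N (k div q)"
    using q by (simp add: fps_nth_compose_X_power minus_mod_eq_mult_div cyclotomic_fps_nth
        inverse_cyclotomic_fps_nth)
  finally show ?thesis .
qed

section \<open>Adjoining primes of the same size\<close>

text \<open>Modulo \<open>x^(2p)\<close> the second factor is just
  \<open>1 - f_1 x^p\<close>.\<close>

lemma fps_mult_inverse_compose_X_power_nth: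
  fixes f :: "'a :: field fps"
  assumes "fps_nth f 0 = 1" "k < 2 * p"
  shows "fps_nth (f * (inverse f oo fps_X ^ p)) k =
    fps_nth f k - fps_nth f 1 * (if p \<le> k then fps_nth f (k - p) else 0)"
proof -
  let ?h = "inverse f oo fps_X ^ p"
  have p: "p > 0" using assms(2) by simp
  have h: "fps_nth ?h i = (if i = 0 then 1 else if i = p then - fps_nth f 1 else 0)" if "i \<le> k" for i
  proof (cases "p dvd i")
    case True
    then obtain l where l: "i = p * l" by blast
    have "p * l < p * 2" using l that assms(2) by linarith
    then have "l = 0 \<or> l = 1" using p by auto
    moreover have "fps_nth (inverse f) 1 = - fps_nth f 1"
      using assms(1) by (simp add: fps_inverse_def)
    ultimately show ?thesis
      using p assms(1) l by (auto simp: fps_nth_compose_X_power)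
  next
    case False
    then have "i \<noteq> 0" "i \<noteq> p" by (metis dvd_0_right, metis dvd_refl)
    with False show ?thesis by (simp add: fps_nth_compose_X_power)
  qed
  have "fps_nth (f * ?h) k = (\<Sum>i=0..k. fps_nth ?h i * fps_nth f (k - i))"
    by (simp add: mult.commute[of f] fps_mult_nth)
  also have "\<dots> = (\<Sum>i\<in>{0..k} \<inter> {0, p}. fps_nth ?h i * fps_nth f (k - i))"
    by (rule sum.mono_neutral_right) (auto simp: h)
  also have "\<dots> = fps_nth f k - fps_nth f 1 * (if p \<le> k then fps_nth f (k - p) else 0)"
  proof (cases "p \<le> k")
    case True
    then have "{0..k} \<inter> {0, p} = {0, p}" by auto
    then show ?thesis using p True assms(1) by (simp add: h)
  next
    case False
    then have "{0..k} \<inter> {0, p} = {0}" by auto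
    then show ?thesis using False assms(1) by (simp add: h)
  qed
  finally show ?thesis .
qed

text \<open>
  Alternating between \<open>\<Phi>\<close> and \<open>1/\<Phi>\<close> with the parity of the number of primes turns the step from \<open>T\<close>
  to \<open>T \<union> {p}\<close> into the single rule \<open>g \<mapsto> g(x) / g(x\<^sup>p)\<close>.
\<close>

definition cyclotomic_fps_alt :: "nat \<Rightarrow> nat set \<Rightarrow> complex fps" where
  "cyclotomic_fps_alt B T =
    (if odd (card T) then cyclotomic_fps (B * \<Prod>T) else inverse (cyclotomic_fps (B * \<Prod>T)))"

lemma cyclotomic_fps_alt_insert:
  assumes "B > 0" "finite T" "p \<notin> T" "\<And>x. x \<in> insert p T \<Longrightarrow> prime x \<and> \<not> x dvd B"
  shows "cyclotomic_fps_alt B (insert p T) =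
    cyclotomic_fps_alt B T * (inverse (cyclotomic_fps_alt B T) oo fps_X ^ p)"
proof -
  let ?N = "B * \<Prod>T"
  have "\<not> p dvd \<Prod>T"
    using assms by (metis insertCI prime_dvd_prod_iff primes_dvd_imp_eq)
  then have ndvd: "\<not> p dvd ?N" using assms(4) by (simp add: prime_dvd_mult_iff)
  have "\<Prod>T > 0" using assms(4) by (intro prod_pos) (auto simp: prime_gt_0_nat)
  then have N: "?N > 0" using assms(1) by simp
  have p: "prime p" using assms(4) by simp
  have prod: "B * \<Prod>(insert p T) = ?N * p" using assms(2,3) by (simp add: mult_ac)
  show ?thesis
  proof (cases "odd (card T)")
    case True
    then show ?thesis
      using assms(2,3) unfolding cyclotomic_fps_alt_def prod
      by (simp add: inverse_cyclotomic_fps_mult_prime[OF N p ndvd] mult.commute[of "_ oo _"] del: prod.insert)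
  next
    case False
    then show ?thesis
      using assms(2,3) unfolding cyclotomic_fps_alt_def prod
      by (simp add: cyclotomic_fps_mult_prime[OF N p ndvd] mult.commute[of "_ oo _"] fps_inverse_idempotent
          cyclotomic_fps_nth_0_nonzero del: prod.insert)
  qed
qed

text \<open>Below \<open>P\<close> no prime of \<open>T\<close> has any effect, so the series agrees
  there with \<open>1 / Phi_B\<close>. Since \<open>P \<ge> 2\<close>, its linear coefficient
  therefore stays \<open>- a(B,1)\<close>; and since \<open>k - p < P\<close>, each new prime shifts
  a copy of \<open>1 / Phi_B\<close> only. Products of two primes' contributions start at
  \<open>x^(2P)\<close>.\<close>

lemma cyclotomic_fps_alt_nth:
  assumes "B > 0" "cyclotomic_coeff B 0 = 1" "P \<ge> 2" "finite T"
    and "\<And>p. p \<in> T \<Longrightarrow> prime p \<and> \<not> p dvd B \<and> P \<le> p" and "k < 2 * P"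
  shows "fps_nth (cyclotomic_fps_alt B T) k = inv_cyclotomic_coeff B k +
    cyclotomic_coeff B 1 * (\<Sum>p | p \<in> T \<and> p \<le> k. inv_cyclotomic_coeff B (k - p))"
  using assms(4-6)
proof (induction T arbitrary: k rule: finite_induct)
  case empty
  then show ?case by (simp add: cyclotomic_fps_alt_def inverse_cyclotomic_fps_nth)
next
  case (insert p T)
  let ?g = "cyclotomic_fps_alt B T"
  have p: "P \<le> p" using insert.prems by simp
  have IH: "fps_nth ?g k = inv_cyclotomic_coeff B k +
      cyclotomic_coeff B 1 * (\<Sum>p | p \<in> T \<and> p \<le> k. inv_cyclotomic_coeff B (k - p))"
    if "k < 2 * P" for k
    using insert.IH insert.prems that by simp
  have small: "fps_nth ?g k = inv_cyclotomic_coeff B k" if "k < P" for k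
  proof -
    have "{p \<in> T. p \<le> k} = {}" using that insert.prems by force
    then have "(\<Sum>p | p \<in> T \<and> p \<le> k. inv_cyclotomic_coeff B (k - p)) = 0"
      by (simp only: sum.empty)
    then show ?thesis using IH[of k] that by simp
  qed
  have g0: "fps_nth ?g 0 = 1"
    using small[of 0] assms(2,3)
    by (simp add: inverse_cyclotomic_fps_nth[symmetric] cyclotomic_fps_nth)
  have g1: "fps_nth ?g 1 = - cyclotomic_coeff B 1"
    using small[of 1] assms(2,3)
    by (simp add: inverse_cyclotomic_fps_nth[symmetric] fps_inverse_def cyclotomic_fps_nth)
  have "fps_nth (cyclotomic_fps_alt B (insert p T)) k =
      fps_nth ?g k + cyclotomic_coeff B 1 * (if p \<le> k then fps_nth ?g (k - p) else 0)"
    using insert.prems insert.hyps assms(1) g1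
      fps_mult_inverse_compose_X_power_nth[OF g0, of k p] p
    by (subst cyclotomic_fps_alt_insert) auto
  also have "\<dots> = inv_cyclotomic_coeff B k + cyclotomic_coeff B 1 *
      ((\<Sum>p | p \<in> T \<and> p \<le> k. inv_cyclotomic_coeff B (k - p)) +
       (if p \<le> k then inv_cyclotomic_coeff B (k - p) else 0))"
    using IH[of k] small[of "k - p"] insert.prems(2) p by (auto simp: algebra_simps)
  also have "(\<Sum>p | p \<in> T \<and> p \<le> k. inv_cyclotomic_coeff B (k - p)) +
       (if p \<le> k then inv_cyclotomic_coeff B (k - p) else 0) =
      (\<Sum>x | x \<in> insert p T \<and> x \<le> k. inv_cyclotomic_coeff B (k - x))"
  proof (cases "p \<le> k")
    case True
    then have "{x. x \<in> insert p T \<and> x \<le> k} = insert p {x \<in> T. x \<le> k}" by auto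
    then show ?thesis using True insert.hyps by simp
  next
    case False
    then have "{x. x \<in> insert p T \<and> x \<le> k} = {x \<in> T. x \<le> k}" by auto
    then show ?thesis using False by simp
  qed
  finally show ?case .
qed

section \<open>Every integer is a coefficient\<close>

text \<open>Supplies the prime preceded by exactly \<open>j\<close> others. The induction removes
  the maximum, which does not affect the rank of any other element.\<close>

lemma finite_set_exists_rank:
  fixes T :: "'a :: linorder set"
  assumes "finite T" "j < card T"
  obtains p where "p \<in> T" "card {x \<in> T. x < p} = j"
  using assms
proof (induction "card T" arbitrary: T j thesis)
  case 0
  then show ?case by simp
next
  case (Suc n)
  have ne: "T \<noteq> {}" using Suc.hyps(2) by auto
  show ?case
  proof (cases "j = n")
    case True
    have "{x \<in> T. x < Max T} = T - {Max T}"
      using Suc.prems(2) by (auto simp: less_le)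
    then have "card {x \<in> T. x < Max T} = j"
      using True Suc.hyps(2) Suc.prems(2) ne by simp
    then show ?thesis using Suc.prems(1) Suc.prems(2) ne Max_in by blast
  next
    case False
    let ?T = "T - {Max T}"
    have "n = card ?T" using Suc.hyps(2) Suc.prems(2) ne by simp
    moreover have "j < card ?T" using False Suc.prems(3) Suc.hyps(2) calculation by simp
    ultimately obtain p where p: "p \<in> ?T" "card {x \<in> ?T. x < p} = j"
      using Suc.hyps(1)[of ?T j] Suc.prems(2) by auto
    have "p \<le> Max T" using p(1) Suc.prems(2) by auto
    then have "{x \<in> ?T. x < p} = {x \<in> T. x < p}" by auto
    with p Suc.prems(1) show ?thesis by auto
  qed
qed

text \<open>The \<open>j\<close> primes of \<open>T\<close> below a chosen \<open>s\<close> each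
  contribute \<open>a(B,1) c(B,v) = - (-1)^i\<close>, and the remaining term \<open>c(B,k)\<close>
  is made to vanish. \<open>b\<close> selects between the polynomial and its inverse,
  \<open>i\<close> the sign.\<close>

lemma cyclotomic_fps_alt_values:
  assumes "finite A" "\<And>p. p \<in> A \<Longrightarrow> prime p" "odd (card A)"
    and "i < 2" "M = \<Prod>A"
  obtains N T k where "N > 0" "M dvd N" "finite T" "even (card T) = b" "\<Prod>T > 0"
    "fps_nth (cyclotomic_fps_alt N T) k = - of_nat j * (-1) ^ i"
proof -
  have A: "A \<noteq> {}" using assms(3) by auto
  have M0: "M > 0" unfolding assms(5) using assms(2) by (intro prod_pos) (auto simp: prime_gt_0_nat)
  have M2: "M \<ge> 2"
  proof -
    obtain p where "p \<in> A" using A by blast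
    then have "p dvd M" "p \<ge> 2"
      using assms(1,2,5) by (auto simp: prime_ge_2_nat intro: dvd_prodI[where f = "\<lambda>x. x"])
    then show ?thesis using M0 dvd_imp_le[of p M] by linarith
  qed
  have M_coeff: "cyclotomic_coeff M 0 = 1" "cyclotomic_coeff M 1 = 1"
    using cyclotomic_fps_prod_primes[OF assms(1,2)] A assms(3)
    by (auto simp: assms(5) cyclotomic_fps_nth)
  have M_inv: "inv_cyclotomic_coeff M 0 = 1" "inv_cyclotomic_coeff M 1 = -1"
    using M_coeff
    by (simp_all add: inverse_cyclotomic_fps_nth[symmetric] fps_inverse_def cyclotomic_fps_nth)
  let ?d = "totient M"
  \<comment> \<open>\<open>q > M\<close> ensures \<open>\<not> q dvd M\<close>; the extra
    \<open>2 * ?d\<close> leaves room for \<open>s mod q + ?d\<close> not to wrap around when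
    \<open>s mod q \<le> ?d\<close>.\<close>
  obtain q where q: "prime q" "q > M + 2 * ?d" using bigger_prime by blast
  have qM: "\<not> q dvd M" using q(2) M0 by (auto dest: dvd_imp_le)
  have qA: "q \<notin> A" using qM assms(1,5) by (auto intro: dvd_prodI[where f = "\<lambda>x. x"])
  define B where "B = M * q"
  have B0: "B > 0" using M0 q by (simp add: B_def)
  have B_coeff: "cyclotomic_coeff B 0 = 1" "cyclotomic_coeff B 1 = -1"
  proof -
    have "B = \<Prod>(insert q A)" using qA assms(1) by (simp add: B_def assms(5) mult.commute)
    moreover have "\<And>p. p \<in> insert q A \<Longrightarrow> prime p" using q assms(2) by auto
    moreover have "finite (insert q A)" using assms(1) by simp
    ultimately have *: "fps_nth (cyclotomic_fps B) 0 = 1"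
      "fps_nth (cyclotomic_fps B) 1 = (-1) ^ (card (insert q A) + 1)"
      using cyclotomic_fps_prod_primes[of "insert q A"] by (auto simp del: prod.insert)
    then show "cyclotomic_coeff B 0 = 1" "cyclotomic_coeff B 1 = -1"
      using assms(1,3) qA by (auto simp: cyclotomic_fps_nth)
  qed
  have c: "inv_cyclotomic_coeff B k = cyclotomic_coeff M (k mod q) * inv_cyclotomic_coeff M (k div q)" for k
    unfolding B_def using M0 q qM by (intro inv_cyclotomic_coeff_mult_prime) auto
  \<comment> \<open>At least \<open>j + 1\<close> primes are needed for one of them to have rank
    \<open>j\<close>; the alternative \<open>j + 2\<close> adjusts the parity.\<close>
  define t where "t = (if even (j + 1) = b then j + 1 else j + 2)"
  \<comment> \<open>\<open>P > B\<close> keeps the primes from dividing \<open>B\<close> and makes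
    the subtraction in \<open>s - B + v\<close> exact.\<close>
  obtain P r where P: "P \<ge> B + 2" "t \<le> card {p. prime p \<and> P \<le> p \<and> p < 2 * P \<and> p mod B = r}"
    using primes_in_residue_class_unbounded[OF B0] by blast
  then obtain T where T: "T \<subseteq> {p. prime p \<and> P \<le> p \<and> p < 2 * P \<and> p mod B = r}" "card T = t" "finite T"
    using obtain_subset_with_card_n[OF P(2)] by blast
  have t: "j < card T" "even (card T) = b" using T(2) by (auto simp: t_def)
  have TB: "prime p \<and> \<not> p dvd B \<and> P \<le> p" if "p \<in> T" for p
    using that T(1) P(1) B0 by (auto dest!: dvd_imp_le)
  obtain s where s: "s \<in> T" "card {x \<in> T. x < s} = j"
    using finite_set_exists_rank[OF T(3) t(1)] by blast
  have s_ge: "s \<ge> P" "s < 2 * P" "prime s" "s mod B = r" using s T(1) by auto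
  \<comment> \<open>This makes \<open>s mod q + ?d\<close> strictly larger than
    \<open>?d\<close>.\<close>
  have "s mod q \<noteq> 0"
  proof
    assume "s mod q = 0"
    then have "q = s" using q(1) s_ge(3) by (simp add: primes_dvd_imp_eq mod_eq_0_iff_dvd)
    moreover have "q \<le> B" using M0 by (simp add: B_def)
    ultimately show False using s_ge(1) P(1) by simp
  qed
  \<comment> \<open>This choice makes \<open>s + e\<close> exceed \<open>\<phi>(M)\<close> modulo \<open>q\<close>, while \<open>a(M,e) = 1\<close>.\<close>
  define e where "e = (if s mod q > ?d then 0 else ?d)"
  \<comment> \<open>By \<open>c\<close>, the coefficient at \<open>v\<close> is
    \<open>a(M,e) c(M,i)\<close>, where \<open>c(M,0) = 1\<close> and
    \<open>c(M,1) = -1\<close>.\<close>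
  define v where "v = q * i + e"
  have e: "e < q" "cyclotomic_coeff M e = 1"
    using q(2) M_coeff cyclotomic_fps_nth_totient[of M] by (auto simp: e_def cyclotomic_fps_nth)
  have "v < B"
  proof -
    have "v < q * (i + 1)" using e by (simp add: v_def)
    also have "\<dots> \<le> q * M" using assms(4) M2 by (intro mult_le_mono) auto
    finally show ?thesis by (simp add: B_def mult.commute)
  qed
  have cv: "inv_cyclotomic_coeff B v = (-1) ^ i"
    using e M_inv assms(4) q by (cases i) (auto simp: c v_def)
  \<comment> \<open>This \<open>k\<close> lies in \<open>[s - B, s)\<close> and is congruent to
    \<open>s + v\<close> modulo \<open>B\<close>. Smaller primes of \<open>T\<close> are at most
    \<open>s - B\<close>, so those up to \<open>k\<close> are exactly those below \<open>s\<close>,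
    and each \<open>k - p\<close> is congruent to \<open>v\<close>.\<close>
  define k where "k = s - B + v"
  have k: "k + B = s + v" using s_ge(1) P(1) by (simp add: k_def)
  have "k mod q = (k + B) mod q" by (simp add: B_def)
  also have "\<dots> = (s mod q + e) mod q"
    unfolding k v_def by (metis (no_types) add.assoc add.commute mod_add_left_eq mod_mult_self2)
  also have "\<dots> > ?d"
  proof (cases "s mod q > ?d")
    case True
    then show ?thesis by (simp add: e_def)
  next
    case False
    then have "s mod q + e < q" using q(2) by (simp add: e_def)
    then show ?thesis using False \<open>s mod q \<noteq> 0\<close> by (simp add: e_def)
  qed
  finally have ck: "inv_cyclotomic_coeff B k = 0"
    using cyclotomic_fps_nth_eq_0[of M "k mod q"] by (simp add: c cyclotomic_fps_nth)
  have gap: "\<exists>l. s = p + B + l * B" if p: "p \<in> T" "p < s" for p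
  proof -
    have "s mod B = p mod B" using p(1) T(1) s_ge by auto
    then have "B dvd s - p" using p(2) by (simp add: mod_eq_dvd_iff_nat)
    then obtain l where l: "s - p = B * l" by blast
    then obtain l' where "l = Suc l'" using p(2) by (cases l) auto
    then show ?thesis using l p(2) by (intro exI[of _ l']) (auto simp: algebra_simps)
  qed
  have "k < s" using \<open>v < B\<close> k by linarith
  have le_iff: "p \<le> k \<longleftrightarrow> p < s" if "p \<in> T" for p
    using gap[OF that] \<open>k < s\<close> k by fastforce
  have "fps_nth (cyclotomic_fps_alt B T) k = inv_cyclotomic_coeff B k +
      cyclotomic_coeff B 1 * (\<Sum>p | p \<in> T \<and> p \<le> k. inv_cyclotomic_coeff B (k - p))"
    using B0 B_coeff P(1) T(3) TB \<open>k < s\<close> s_ge(2) by (intro cyclotomic_fps_alt_nth[where P = P]) auto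
  also have "(\<Sum>p | p \<in> T \<and> p \<le> k. inv_cyclotomic_coeff B (k - p)) = (\<Sum>p | p \<in> T \<and> p < s. (-1) ^ i)"
  proof (rule sum.cong)
    show "inv_cyclotomic_coeff B (k - p) = (-1) ^ i" if p: "p \<in> {p \<in> T. p < s}" for p
    proof -
      obtain l where "s = p + B + l * B" using gap p by blast
      then have "k - p = v + l * B" using k by simp
      then show ?thesis using inv_cyclotomic_coeff_add_multiple[OF B0] cv by simp
    qed
  qed (use le_iff in auto)
  also have "\<dots> = of_nat j * (-1) ^ i" using s(2) by simp
  finally have "fps_nth (cyclotomic_fps_alt B T) k = - of_nat j * (-1) ^ i"
    using ck B_coeff by simp
  moreover have "\<Prod>T > 0" using TB by (intro prod_pos) (auto simp: prime_gt_0_nat)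
  moreover have "M dvd B" by (simp add: B_def)
  ultimately show ?thesis
    by (intro that[OF B0 _ T(3) t(2)])
qed

lemma cyclotomic_fps_alt_attains_int:
  fixes z :: int
  assumes "m > 0"
  obtains N T k where "N > 0" "finite T" "even (card T) = b" "\<Prod>T > 0"
    "\<forall>p. prime p \<longrightarrow> p dvd m \<longrightarrow> p dvd N"
    "fps_nth (cyclotomic_fps_alt N T) k = of_int z"
proof -
  obtain q where q: "prime q" "q > m" using bigger_prime by blast
  have qm: "q \<notin> prime_factors m" using q assms by (auto dest!: dvd_imp_le)
  \<comment> \<open>The prime factors of \<open>m\<close>, padded by a new prime if needed to make
    their number odd; this also covers \<open>m = 1\<close>.\<close>
  define A where "A = (if odd (card (prime_factors m)) then prime_factors m
    else insert q (prime_factors m))"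
  have A: "finite A" "\<And>p. p \<in> A \<Longrightarrow> prime p" "odd (card A)"
    using q qm by (auto simp: A_def split: if_splits)
  \<comment> \<open>The attained value is \<open>- j * (-1) ^ i\<close>, hence \<open>i = 1\<close>
    for nonnegative \<open>z\<close>.\<close>
  define i :: nat where "i = (if z \<ge> 0 then 1 else 0)"
  have "i < 2" by (simp add: i_def)
  obtain N T k where N: "N > 0" "\<Prod>A dvd N" "finite T" "even (card T) = b" "\<Prod>T > 0"
    "fps_nth (cyclotomic_fps_alt N T) k = - of_nat (nat \<bar>z\<bar>) * (-1) ^ i"
    by (rule cyclotomic_fps_alt_values[OF A \<open>i < 2\<close> refl, of b "nat \<bar>z\<bar>"])
  have "p dvd N" if "prime p" "p dvd m" for p
  proof -
    have "p \<in> A" using that assms by (auto simp: A_def in_prime_factors_iff)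
    then have "p dvd \<Prod>A" using A(1) by (auto intro: dvd_prodI[where f = "\<lambda>x. x"])
    then show ?thesis using N(2) dvd_trans by blast
  qed
  moreover have "- of_nat (nat \<bar>z\<bar>) * (-1) ^ i = (of_int z :: complex)"
    by (auto simp: i_def)
  ultimately show ?thesis
    by (intro that[OF N(1,3,4,5)]) (use N(6) in auto)
qed

theorem theorem1:
  fixes m :: nat
  assumes "m \<ge> 1"
  shows "{cyclotomic_coeff (m * n) k | n k. n \<ge> 1} = \<int> \<and>
         {inv_cyclotomic_coeff (m * n) k | n k. n \<ge> 1} = \<int>"
proof -
  have m: "m > 0" using assms by simp
  \<comment> \<open>Since all primes of \<open>m\<close> divide \<open>N\<close>, the factor
    \<open>m\<close> only substitutes \<open>x^m\<close> for \<open>x\<close>: coefficient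
    \<open>k\<close> reappears at \<open>k * m\<close>. Odd \<open>card T\<close> then serves the
    polynomials, even \<open>card T\<close> their inverses.\<close>
  have absorb: "cyclotomic_fps (m * (N * \<Prod>T)) = cyclotomic_fps (N * \<Prod>T) oo fps_X ^ m"
    if "N > 0" "\<Prod>T > 0" "\<And>p. prime p \<Longrightarrow> p dvd m \<Longrightarrow> p dvd N" for N :: nat and T
    using cyclotomic_fps_mult_absorb[of "N * \<Prod>T" m] that m by (simp add: mult.commute)
  have "z \<in> {cyclotomic_coeff (m * n) k | n k. n \<ge> 1}" if z: "z \<in> \<int>" for z
  proof -
    obtain z' where z': "z = of_int z'" using z by (rule Ints_cases)
    obtain N T k where N: "N > 0" "finite T" "even (card T) = False" "\<Prod>T > 0"
      "\<forall>p. prime p \<longrightarrow> p dvd m \<longrightarrow> p dvd N" "fps_nth (cyclotomic_fps_alt N T) k = of_int z'"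
      by (rule cyclotomic_fps_alt_attains_int[OF m, of False z'])
    have "cyclotomic_coeff (m * (N * \<Prod>T)) (k * m) = z"
      using N m z' by (simp add: cyclotomic_fps_nth[symmetric] absorb fps_nth_compose_X_power
          cyclotomic_fps_alt_def)
    moreover have "N * \<Prod>T \<ge> 1" using N by (simp add: Suc_leI del: prod_pos_nat_iff)
    ultimately show ?thesis by blast
  qed
  moreover have "z \<in> {inv_cyclotomic_coeff (m * n) k | n k. n \<ge> 1}" if z: "z \<in> \<int>" for z
  proof -
    obtain z' where z': "z = of_int z'" using z by (rule Ints_cases)
    obtain N T k where N: "N > 0" "finite T" "even (card T) = True" "\<Prod>T > 0"
      "\<forall>p. prime p \<longrightarrow> p dvd m \<longrightarrow> p dvd N" "fps_nth (cyclotomic_fps_alt N T) k = of_int z'"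
      by (rule cyclotomic_fps_alt_attains_int[OF m, of True z'])
    have "inv_cyclotomic_coeff (m * (N * \<Prod>T)) (k * m) =
        fps_nth (inverse (cyclotomic_fps (N * \<Prod>T)) oo fps_X ^ m) (k * m)"
      using N m by (simp add: inverse_cyclotomic_fps_nth[symmetric] absorb fps_inverse_compose
          cyclotomic_fps_nth_0_nonzero)
    then have "inv_cyclotomic_coeff (m * (N * \<Prod>T)) (k * m) = z"
      using N m z' by (simp add: fps_nth_compose_X_power cyclotomic_fps_alt_def)
    moreover have "N * \<Prod>T \<ge> 1" using N by (simp add: Suc_leI del: prod_pos_nat_iff)
    ultimately show ?thesis by blast
  qed
  moreover have "cyclotomic_coeff (m * n) k \<in> \<int>" "inv_cyclotomic_coeff (m * n) k \<in> \<int>"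
    if "n \<ge> 1" for n k
    using that m by (auto intro: cyclotomic_coeff_Ints inv_cyclotomic_coeff_Ints)
  ultimately show ?thesis by blast
qed

end
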